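(* Let $\mathbb{F}$ be a field and let $W(t)=\sum_{n=0}^{\infty}\frac{t^n}{w_n}\in\mathbb{F}[[t]]$ with $w_0=1$ and $w_n\neq0$ for all $n$. A graded sequence $\{p_n(x)\}_{n\in\mathbb{N}}$ of polynomials in $\mathbb{F}[x]$ is $W$-Sheffer if and only if there exists a graded sequence $\{d_l(x)\}_{l\in\mathbb{N}}$ of polynomials in $\mathbb{F}[x]$ such that $$(\varphi\cdot_W\psi)\Big(\frac{p_n}{w_n}\Big)=\sum_{k=0}^n\varphi\Big(\frac{p_k}{w_k}\Big)\psi\Big(\frac{d_{n-k}}{w_{n-k}}\Big)$$ for every $n\in\mathbb{N}$ and all $\varphi,\psi\in\mathbb{F}[x]^*$.
   Context: $\mathbb{N}=\{0,1,2,\dots\}$. A sequence of polynomials $\{p_n\}_{n\in\mathbb{N}}$ is graded if $\deg p_n=n$ for all $n$. $\mathbb{F}[x]^*$ is the space of linear functionals on $\mathbb{F}[x]$, with the product $\cdot_W$ defined by $(\varphi\cdot_W\psi)\big(\frac{x^n}{w_n}\big)=\sum_{k=0}^n\varphi\big(\frac{x^k}{w_k}\big)\psi\big(\frac{x^{n-k}}{w_{n-k}}\big)$ for all $n$. For $h\in\mathbb{F}$ the $W$-translation $T_{h,W}$ is the linear operator on $\mathbb{F}[x]$ taking $\frac{x^n}{w_n}$ to $\sum_{k=0}^n\frac{h^{n-k}}{w_{n-k}}\cdot\frac{x^k}{w_k}$. For a graded sequence $\{p_n\}$, $Q_W$ is the linear operator on $\mathbb{F}[x]$ sending $\frac{p_n}{w_n}$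 to $\frac{p_{n-1}}{w_{n-1}}$ for $n\geq1$ and $p_0$ to $0$. The graded sequence is called $W$-Sheffer if $Q_W$ commutes with $T_{h,W}$ for all $h\in\mathbb{F}$. *)

theory Defs
  imports Complex_Main "HOL-Computational_Algebra.Polynomial"
begin

text \<open>The condition \<^term>\<open>p n \<noteq> 0\<close> is needed because the zero polynomial has \<^const>\<open>degree\<close> 0 in
  HOL: the constant term of a graded sequence is a nonzero constant.\<close>

definition graded :: "(nat \<Rightarrow> 'a::field poly) \<Rightarrow> bool" where
  "graded p \<longleftrightarrow> (\<forall>n. p n \<noteq> 0 \<and> degree (p n) = n)"

definition poly_dual :: "('a::field poly \<Rightarrow> 'a) set" where
  "poly_dual = {\<phi>. Vector_Spaces.linear smult (*) \<phi>}"

text \<open>Throughout, the series \<open>W(t) = \<Sum>n. t^n / w n\<close> is given by the sequence \<open>w\<close>, and the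
  polynomial \<open>p n / w n\<close> is written \<open>normalized w p n\<close>.\<close>

definition normalized :: "(nat \<Rightarrow> 'a::field) \<Rightarrow> (nat \<Rightarrow> 'a poly) \<Rightarrow> nat \<Rightarrow> 'a poly" where
  "normalized w p n = smult (inverse (w n)) (p n)"

abbreviation normalized_power :: "(nat \<Rightarrow> 'a::field) \<Rightarrow> nat \<Rightarrow> 'a poly" where
  "normalized_power w \<equiv> normalized w (monom 1)"

text \<open>The next three maps are specified by linearity and their values on a basis.  Existence and
  uniqueness, for \<open>w\<close> without zeros (and \<open>p\<close> graded, \<open>w 0 = 1\<close> for the third), are proved below.\<close>

definition W_prod ::
  "(nat \<Rightarrow> 'a::field) \<Rightarrow> ('a poly \<Rightarrow> 'a) \<Rightarrow> ('a poly \<Rightarrow> 'a) \<Rightarrow> 'a poly \<Rightarrow> 'a" where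
  "W_prod w \<phi> \<psi> = (THE \<chi>. \<chi> \<in> poly_dual \<and>
     (\<forall>n. \<chi> (normalized_power w n) =
        (\<Sum>k\<le>n. \<phi> (normalized_power w k) * \<psi> (normalized_power w (n - k)))))"

definition W_translation :: "(nat \<Rightarrow> 'a::field) \<Rightarrow> 'a \<Rightarrow> 'a poly \<Rightarrow> 'a poly" where
  "W_translation w h = (THE T. Vector_Spaces.linear smult smult T \<and>
     (\<forall>n. T (normalized_power w n) =
        (\<Sum>k\<le>n. smult (h ^ (n - k) / w (n - k)) (normalized_power w k))))"

definition Q_op :: "(nat \<Rightarrow> 'a::field) \<Rightarrow> (nat \<Rightarrow> 'a poly) \<Rightarrow> 'a poly \<Rightarrow> 'a poly" where
  "Q_op w p = (THE Q. Vector_Spaces.linear smult smult Q \<and> Q (p 0) = 0 \<and>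
     (\<forall>n\<ge>1. Q (normalized w p n) = normalized w p (n - 1)))"

definition W_Sheffer :: "(nat \<Rightarrow> 'a::field) \<Rightarrow> (nat \<Rightarrow> 'a poly) \<Rightarrow> bool" where
  "W_Sheffer w p \<longleftrightarrow> graded p \<and>
     (\<forall>h. Q_op w p \<circ> W_translation w h = W_translation w h \<circ> Q_op w p)"

lemma vector_space_smult: "vector_space (smult :: 'a::field \<Rightarrow> 'a poly \<Rightarrow> 'a poly)"
  by unfold_locales (simp_all add: smult_add_right smult_add_left)

lemma vector_space_times: "vector_space ((*) :: 'a::field \<Rightarrow> 'a \<Rightarrow> 'a)"
  by unfold_locales (simp_all add: algebra_simps)

lemma graded_monom: "graded (monom (1::'a::field))"
  by (simp add: graded_def degree_monom_eq)

lemma graded_normalized: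
  assumes "graded p" "\<And>n. w n \<noteq> 0"
  shows "graded (normalized w p)"
  using assms by (simp add: graded_def normalized_def)

lemma ex1_linear_graded:
  fixes b :: "nat \<Rightarrow> 'a::field poly" and s :: "'a \<Rightarrow> 'b::ab_group_add \<Rightarrow> 'b" and f :: "nat \<Rightarrow> 'b"
  assumes b: "graded b" and s: "vector_space s"
  shows "\<exists>!L. Vector_Spaces.linear smult s L \<and> (\<forall>n. L (b n) = f n)"
proof -
  interpret vector_space_pair "smult :: 'a \<Rightarrow> 'a poly \<Rightarrow> 'a poly" s
    by (simp add: vector_space_pair_def s vector_space_smult)
  have deg: "degree (b n) = n" and nz: "b n \<noteq> 0" for n
    using b by (auto simp: graded_def)
  have inj: "inj b"
    by (metis deg injI)
  have "vs1.independent (range b)"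
    unfolding vs1.independent_explicit_finite_subsets
  proof (intro allI impI ballI)
    fix S and u :: "'a poly \<Rightarrow> 'a" and v0
    assume S: "S \<subseteq> range b" "finite S" and 0: "(\<Sum>v\<in>S. smult (u v) v) = 0" and v0: "v0 \<in> S"
    show "u v0 = 0"
    proof (rule ccontr)
      define S' where "S' = {v\<in>S. u v \<noteq> 0}"
      assume "u v0 \<noteq> 0"
      then have ne: "S' \<noteq> {}" "finite S'"
        using v0 S by (auto simp: S'_def)
      obtain v where v: "v \<in> S'" "\<And>v'. v' \<in> S' \<Longrightarrow> degree v' \<le> degree v"
      proof -
        have "Max (degree ` S') \<in> degree ` S'" using ne by (intro Max_in) auto
        then obtain v where "v \<in> S'" "Max (degree ` S') = degree v" by auto
        moreover have "degree v' \<le> Max (degree ` S')" if "v' \<in> S'" for v'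
          using ne that by (intro Max_ge) auto
        ultimately show ?thesis using that by metis
      qed
      have vS: "v \<in> S" using v by (simp add: S'_def)
      have "u v' * coeff v' (degree v) = 0" if "v' \<in> S" "v' \<noteq> v" for v'
      proof (cases "u v' = 0")
        case False
        then have "degree v' \<le> degree v" using that v by (simp add: S'_def)
        moreover have "degree v' \<noteq> degree v"
          using that vS S(1) deg by (metis image_iff subsetD)
        ultimately show ?thesis by (simp add: coeff_eq_0)
      qed simp
      then have "(\<Sum>v'\<in>S. u v' * coeff v' (degree v)) = u v * coeff v (degree v)"
        using S(2) vS by (subst sum.remove[of _ v]) (simp, simp, metis (mono_tags, lifting) DiffE add.right_neutral insertCI sum.neutral)
      moreover have "(\<Sum>v'\<in>S. u v' * coeff v' (degree v)) = 0"
        using arg_cong[OF 0, of "\<lambda>p. coeff p (degree v)"] by (simp add: coeff_sum)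
      moreover have "v \<noteq> 0" using vS S(1) nz by auto
      ultimately show False using v by (simp add: S'_def)
    qed
  qed
  then obtain L where L: "Vector_Spaces.linear smult s L" "\<forall>x\<in>range b. L x = f (inv b x)"
    using linear_independent_extend[of "range b" "\<lambda>x. f (inv b x)"] by blast
  have span: "p \<in> vs1.span (range b)" if "degree p \<le> n" for n p
    using that
  proof (induction n arbitrary: p)
    case (0 p)
    then obtain c where p: "p = [:c:]"
      using degree_eq_zeroE by blast
    obtain d where d: "b 0 = [:d:]" using deg[of 0] degree_eq_zeroE by blast
    have "d \<noteq> 0" using nz[of 0] d by auto
    then have "p = smult (c / d) (b 0)" by (simp add: p d)
    then show ?case by (simp add: vs1.span_base vs1.span_scale)
  next
    case (Suc n p)
    define c where "c = coeff p (Suc n) / coeff (b (Suc n)) (Suc n)"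
    define q where "q = p - smult c (b (Suc n))"
    have "coeff (b (Suc n)) (Suc n) \<noteq> 0"
      using nz[of "Suc n"] deg[of "Suc n"] by (metis leading_coeff_0_iff)
    then have "coeff q (Suc n) = 0" by (simp add: q_def c_def)
    moreover have "degree q \<le> Suc n"
      unfolding q_def using Suc.prems deg
      by (intro degree_diff_le order_trans[OF degree_smult_le]) auto
    ultimately have "degree q \<le> n"
      using leading_coeff_0_iff[of q] by (cases "degree q = Suc n") auto
    then have "q + smult c (b (Suc n)) \<in> vs1.span (range b)"
      using Suc.IH by (intro vs1.span_add vs1.span_scale) (auto intro: vs1.span_base)
    then show ?case by (simp add: q_def)
  qed
  show ?thesis
  proof (rule ex1I)
    show "Vector_Spaces.linear smult s L \<and> (\<forall>n. L (b n) = f n)"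
      using L inj by simp
  next
    fix M assume M: "Vector_Spaces.linear smult s M \<and> (\<forall>n. M (b n) = f n)"
    show "M = L"
    proof
      fix p
      show "M p = L p"
        by (rule linear_eq_on[of M L p "range b"]) (use M L inj span[OF order_refl] in auto)
    qed
  qed
qed

lemma W_prod_unique:
  assumes "\<And>n. w n \<noteq> 0"
  shows "\<exists>!\<chi>. \<chi> \<in> poly_dual \<and>
     (\<forall>n. \<chi> (normalized_power w n) =
        (\<Sum>k\<le>n. \<phi> (normalized_power w k) * \<psi> (normalized_power w (n - k))))"
  unfolding poly_dual_def mem_Collect_eq
  by (intro ex1_linear_graded graded_normalized graded_monom vector_space_times assms)

lemma W_translation_unique:
  assumes "\<And>n. w n \<noteq> 0"
  shows "\<exists>!T. Vector_Spaces.linear smult smult T \<and>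
     (\<forall>n. T (normalized_power w n) =
        (\<Sum>k\<le>n. smult (h ^ (n - k) / w (n - k)) (normalized_power w k)))"
  by (intro ex1_linear_graded graded_normalized graded_monom vector_space_smult assms)

lemma Q_op_unique:
  assumes "graded p" "w 0 = 1" "\<And>n. w n \<noteq> 0"
  shows "\<exists>!Q. Vector_Spaces.linear smult smult Q \<and> Q (p 0) = 0 \<and>
     (\<forall>n\<ge>1. Q (normalized w p n) = normalized w p (n - 1))"
proof -
  have "Q (p 0) = 0 \<and> (\<forall>n\<ge>1. Q (normalized w p n) = normalized w p (n - 1)) \<longleftrightarrow>
      (\<forall>n. Q (normalized w p n) = (if n = 0 then 0 else normalized w p (n - 1)))"
    for Q :: "'a poly \<Rightarrow> 'a poly"
  proof -
    have "normalized w p 0 = p 0" using assms(2) by (simp add: normalized_def)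
    then show ?thesis by (metis One_nat_def Suc_leI neq0_conv not_one_le_zero)
  qed
  then show ?thesis
    using ex1_linear_graded[OF graded_normalized[OF assms(1,3)] vector_space_smult,
        where f = "\<lambda>n. if n = 0 then 0 else normalized w p (n - 1)"] by simp
qed

lemmas W_prod_spec = theI'[OF W_prod_unique, folded W_prod_def]
lemmas W_translation_spec = theI'[OF W_translation_unique, folded W_translation_def]
lemmas Q_op_spec = theI'[OF Q_op_unique, folded Q_op_def]

end

theory Submission
  imports Defs
begin

text \<open>
  Write \<open>u n = x ^ n / w n\<close> and \<open>P n = p n / w n\<close>.  A functional \<open>\<psi>\<close> gives an operator
  \<open>S\<^sub>\<psi>\<close> (\<open>dual_op\<close> below), which sends \<open>u n\<close> to \<open>\<Sum>k\<le>n. \<psi> (u (n - k)) u k\<close>.  With \<open>D\<close> the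
  operator \<open>u n \<mapsto> u (n - 1)\<close> it is the power series \<open>\<Sum>j. \<psi> (u j) D ^ j\<close>, and it turns the product
  of functionals into composition: \<open>(\<phi> \<cdot> \<psi>) q = \<phi> (S\<^sub>\<psi> q) = \<psi> (S\<^sub>\<phi> q)\<close>.  Translation by \<open>h\<close> is
  \<open>S\<^sub>\<psi>\<close> for \<open>\<psi>\<close> evaluation at \<open>h\<close>.  As functionals separate polynomials, the identity in the
  theorem says that, for all \<open>n\<close> and \<open>\<psi>\<close>,

  \<open>S\<^sub>\<psi> (P n) = \<Sum>k\<le>n. \<psi> (d (n - k) / w (n - k)) P k\<close>.   (E)

  Given (E), the coefficient of \<open>P k\<close> depends only on \<open>n - k\<close>, so \<open>S\<^sub>\<psi>\<close> commutes with the shift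
  \<open>Q\<close> on the basis \<open>P\<close>; this covers all translations (\<open>W_Sheffer_if_expansion\<close>).

  Conversely, suppose that \<open>Q\<close> commutes with the translations.  Then \<open>Q\<close> commutes with every
  \<open>S\<^sub>\<psi>\<close>.  Comparing coefficients of powers of \<open>h\<close> would show this over an infinite field only; over
  any field, translation by 1 alone is enough, because \<open>T\<^sub>1 - 1 = D / w 1 + D\<^sup>2 / w 2 + \<dots>\<close> lowers
  degrees by exactly one and operators that commute with such an operator commute with each other
  (\<open>commutant_of_lowering_commutes\<close>).  Let \<open>\<pi>\<close> be the functional with \<open>\<pi> (P n) = 0\<close> for \<open>n > 0\<close>
  and \<open>\<pi> (P 0) = 1\<close>, and let \<open>d n / w n = S\<^sub>\<pi> (P n)\<close>.  This choice is forced by applying \<open>\<pi>\<close> to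
  (E), since \<open>\<pi> (S\<^sub>\<psi> (P n)) = \<psi> (S\<^sub>\<pi> (P n))\<close>.  It satisfies (E) by induction on \<open>n\<close>:
  the difference of the two sides is killed by \<open>Q\<close>, hence is constant, and it is killed by \<open>\<pi>\<close>,
  hence is 0 (\<open>W_Sheffer_expansion\<close>).
\<close>

section \<open>Linear maps on polynomials\<close>

abbreviation poly_endo :: "('a::field poly \<Rightarrow> 'a poly) \<Rightarrow> bool" where
  "poly_endo \<equiv> Vector_Spaces.linear smult smult"

lemma linear_polyI:
  fixes L :: "'a::field poly \<Rightarrow> 'b::ab_group_add"
  assumes "vector_space s" "\<And>p q. L (p + q) = L p + L q" "\<And>c p. L (smult c p) = s c (L p)"
  shows "Vector_Spaces.linear smult s L"
  using assms vector_space_smult by (simp add: Vector_Spaces.linear_iff)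

lemma linear_polyD:
  fixes L :: "'a::field poly \<Rightarrow> 'b::ab_group_add"
  assumes "Vector_Spaces.linear smult s L"
  shows "L (p + q) = L p + L q" "L (smult c p) = s c (L p)" "L 0 = 0" "L (p - q) = L p - L q"
    "L (sum f I) = (\<Sum>i\<in>I. L (f i))"
proof -
  interpret module_hom smult s L
    using assms by (simp add: linear_iff_module_hom)
  show "L (p + q) = L p + L q" "L (smult c p) = s c (L p)" "L 0 = 0" "L (p - q) = L p - L q"
    "L (sum f I) = (\<Sum>i\<in>I. L (f i))"
    by (simp_all add: add scale diff sum)
qed

lemma poly_endoI:
  assumes "\<And>p q. L (p + q) = L p + L q" "\<And>c p. L (smult c p) = smult c (L p)"
  shows "poly_endo L"
  using assms by (intro linear_polyI vector_space_smult)

lemma linear_compose_endo: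
  assumes "vector_space s" "Vector_Spaces.linear smult s L" "poly_endo M"
  shows "Vector_Spaces.linear smult s (\<lambda>p. L (M p))"
  using assms by (intro linear_polyI) (simp_all add: linear_polyD[OF assms(2)] linear_polyD[OF assms(3)])

lemma linear_eq_on_graded:
  fixes L M :: "'a::field poly \<Rightarrow> 'b::ab_group_add"
  assumes "graded b" "vector_space s"
    and "Vector_Spaces.linear smult s L" "Vector_Spaces.linear smult s M"
    and "\<And>n. L (b n) = M (b n)"
  shows "L = M"
  using ex1_linear_graded[OF assms(1,2), of "\<lambda>n. M (b n)"] assms(3-5) by blast

lemma graded_split_leading:
  fixes b :: "nat \<Rightarrow> 'a::field poly"
  assumes "graded b" "degree p \<le> N"
  shows "\<exists>c r. p = smult c (b N) + r \<and> (r = 0 \<or> degree r < N)"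
proof -
  define c where "c = coeff p N / coeff (b N) N"
  define r where "r = p - smult c (b N)"
  have b: "b N \<noteq> 0" "degree (b N) = N"
    using assms(1) by (auto simp: graded_def)
  then have "coeff (b N) N \<noteq> 0"
    by (metis leading_coeff_0_iff)
  then have 0: "coeff r N = 0"
    by (simp add: r_def c_def)
  have "degree r \<le> N"
    unfolding r_def using assms(2) b by (intro degree_diff_le order_trans[OF degree_smult_le]) auto
  with 0 have "r = 0 \<or> degree r < N"
    by (metis leading_coeff_0_iff order.not_eq_order_implies_strict)
  then show ?thesis
    by (intro exI[of _ c] exI[of _ r]) (simp add: r_def)
qed

lemma graded_sum_leading:
  fixes b :: "nat \<Rightarrow> 'a::field poly"
  assumes "graded b" "c n \<noteq> 0"
  shows "(\<Sum>k\<le>n. smult (c k) (b k)) \<noteq> 0 \<and> degree (\<Sum>k\<le>n. smult (c k) (b k)) = n"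
proof -
  have b: "b k \<noteq> 0" "degree (b k) = k" for k
    using assms(1) by (auto simp: graded_def)
  have "coeff (\<Sum>k\<le>n. smult (c k) (b k)) n = (\<Sum>k\<le>n. if k = n then c n * coeff (b n) n else 0)"
    unfolding coeff_sum using b by (intro sum.cong) (auto simp: coeff_eq_0)
  also have "\<dots> = c n * lead_coeff (b n)"
    by (simp add: b)
  finally have "coeff (\<Sum>k\<le>n. smult (c k) (b k)) n \<noteq> 0"
    using assms(2) b(1)[of n] b(2)[of n] by (metis leading_coeff_0_iff mult_eq_0_iff)
  moreover have "degree (\<Sum>k\<le>n. smult (c k) (b k)) \<le> n"
    by (intro degree_sum_le) (auto intro: order_trans[OF degree_smult_le] simp: b)
  ultimately show ?thesis
    by (metis coeff_0 le_antisym le_degree)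
qed

section \<open>Lowering operators\<close>

text \<open>In HOL the zero polynomial has degree 0, so the kernel is the space of constants and the
  degree equation also covers \<open>A p = 0\<close>.\<close>

definition lowering :: "('a::field poly \<Rightarrow> 'a poly) \<Rightarrow> bool" where
  "lowering A \<longleftrightarrow> poly_endo A \<and> (\<forall>p. A p = 0 \<longleftrightarrow> degree p = 0) \<and>
     (\<forall>p. degree (A p) = degree p - 1)"

text \<open>The leading term of \<open>p\<close> with respect to \<open>b\<close> determines the leading term of \<open>L p\<close>: the rest
  of \<open>p\<close> has smaller degree, and by induction so has its image.\<close>

lemma lowering_on_graded:
  fixes L :: "'a::field poly \<Rightarrow> 'a poly"
  assumes b: "graded b" and L: "poly_endo L" and 0: "L (b 0) = 0"
    and Suc: "graded (\<lambda>n. L (b (Suc n)))"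
  shows "lowering L"
proof -
  have const: "L p = 0" if p: "degree p = 0" for p
  proof -
    obtain c r where "p = smult c (b 0) + r" "r = 0 \<or> degree r < 0"
      using graded_split_leading[OF b, of p 0] p by auto
    then show ?thesis
      by (simp add: linear_polyD[OF L] 0)
  qed
  have step: "L p \<noteq> 0 \<and> degree (L p) = n" if "degree p = Suc n" for p n
    using that
  proof (induction n arbitrary: p rule: less_induct)
    case (less n)
    obtain c r where p: "p = smult c (b (Suc n)) + r" and r: "r = 0 \<or> degree r < Suc n"
      using graded_split_leading[OF b, of p "Suc n"] less.prems by auto
    have "c \<noteq> 0"
      using p r less.prems by auto
    then have c: "smult c (L (b (Suc n))) \<noteq> 0" "degree (smult c (L (b (Suc n)))) = n"
      using Suc by (auto simp: graded_def)
    have Lr: "L r = 0 \<or> degree (L r) < n"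
    proof (cases "degree r")
      case 0
      then show ?thesis by (simp add: const)
    next
      case (Suc m)
      with r have "m < n" by auto
      then show ?thesis using less.IH[OF _ Suc] by simp
    qed
    have "L p = smult c (L (b (Suc n))) + L r"
      by (simp add: p linear_polyD[OF L])
    moreover have "degree (smult c (L (b (Suc n))) + L r) = n"
      using Lr c by (auto simp: degree_add_eq_left)
    moreover have "smult c (L (b (Suc n))) + L r \<noteq> 0"
      using Lr c by (metis add.right_neutral add_eq_0_iff degree_minus less_irrefl)
    ultimately show ?case by simp
  qed
  show ?thesis
    unfolding lowering_def
  proof (intro conjI allI)
    fix p
    show "L p = 0 \<longleftrightarrow> degree p = 0" "degree (L p) = degree p - 1"
      using const[of p] step[of p "degree p - 1"] by (cases "degree p"; auto)+
  qed (rule L)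
qed

lemma funpow_lowering:
  assumes "lowering A"
  shows "degree p < N \<Longrightarrow> (A ^^ N) p = 0"
    and "degree p = N \<Longrightarrow> p \<noteq> 0 \<Longrightarrow> (A ^^ N) p \<noteq> 0 \<and> degree ((A ^^ N) p) = 0"
proof -
  have A: "poly_endo A" "\<And>p. A p = 0 \<longleftrightarrow> degree p = 0" "\<And>p. degree (A p) = degree p - 1"
    using assms by (auto simp: lowering_def)
  have 0: "(A ^^ n) 0 = 0" for n
    by (induction n) (simp_all add: linear_polyD[OF A(1)])
  show "degree p < N \<Longrightarrow> (A ^^ N) p = 0"
  proof (induction N arbitrary: p)
    case (Suc N)
    then have "degree (A p) < N \<or> A p = 0"
      using A by (cases "degree p") auto
    then show ?case
      using Suc.IH[of "A p"] 0 by (auto simp: funpow_Suc_right simp del: funpow.simps)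
  qed simp
  show "degree p = N \<Longrightarrow> p \<noteq> 0 \<Longrightarrow> (A ^^ N) p \<noteq> 0 \<and> degree ((A ^^ N) p) = 0"
  proof (induction N arbitrary: p)
    case (Suc N)
    then have "degree (A p) = N" "A p \<noteq> 0"
      using A by auto
    then show ?case
      using Suc.IH[of "A p"] by (auto simp: funpow_Suc_right simp del: funpow.simps)
  qed simp
qed

text \<open>An operator \<open>S\<close> that commutes with \<open>A\<close> is a power series in \<open>A\<close>, so \<open>Q\<close> commutes with it.
  The series is built one term at a time: if a polynomial \<open>R\<close> in \<open>A\<close> agrees with \<open>S\<close> below
  degree \<open>N\<close>, then \<open>A\<close> kills \<open>(S - R) x ^ N\<close>, which is therefore a constant, and so a multiple of
  the nonzero constant \<open>A ^ N x ^ N\<close>.  Adding that multiple of \<open>A ^ N\<close>, which is zero below degree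
  \<open>N\<close>, corrects \<open>R\<close> in degree \<open>N\<close>.  The induction records only the two properties of a
  polynomial in \<open>A\<close> that matter: it commutes with \<open>A\<close> and with \<open>Q\<close>.\<close>

lemma commutant_of_lowering_commutes:
  fixes A S Q :: "'a::field poly \<Rightarrow> 'a poly"
  assumes "lowering A" and S: "poly_endo S" and Q: "poly_endo Q"
    and SA: "\<And>p. S (A p) = A (S p)" and QA: "\<And>p. Q (A p) = A (Q p)"
  shows "Q (S p) = S (Q p)"
proof -
  have A: "poly_endo A" "\<And>p. A p = 0 \<longleftrightarrow> degree p = 0" "\<And>p. degree (A p) = degree p - 1"
    using assms by (auto simp: lowering_def)
  note lin = linear_polyD[OF A(1)] linear_polyD[OF S] linear_polyD[OF Q]
  have approx: "\<exists>R. poly_endo R \<and> (\<forall>p. R (A p) = A (R p)) \<and> (\<forall>p. Q (R p) = R (Q p)) \<and>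
      (\<forall>p. degree p < N \<longrightarrow> R p = S p)" for N
  proof (induction N)
    case 0
    then show ?case
      by (intro exI[of _ "\<lambda>_. 0"]) (auto intro: poly_endoI simp: lin)
  next
    case (Suc N)
    then obtain R where R: "poly_endo R" and RA: "\<And>p. R (A p) = A (R p)"
      and RQ: "\<And>p. Q (R p) = R (Q p)" and RS: "\<And>p. degree p < N \<Longrightarrow> R p = S p"
      by blast
    define x :: "'a poly" where "x = monom 1 N"
    have x: "degree x = N" "x \<noteq> 0"
      by (simp_all add: x_def degree_monom_eq)
    have "R (A x) = S (A x)"
    proof (cases N)
      case 0
      then have "A x = 0" using A(2)[of x] x by simp
      then show ?thesis by (simp add: lin linear_polyD[OF R])
    qed (use RS[of "A x"] A(3)[of x] x in auto)
    then have "A (S x - R x) = 0"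
      by (simp add: lin SA[symmetric] RA[symmetric])
    then obtain e where e: "S x - R x = [:e:]"
      using A(2) degree_eq_zeroE by blast
    obtain f where f: "(A ^^ N) x = [:f:]" "f \<noteq> 0"
      using funpow_lowering(2)[OF assms(1) x] degree_eq_zeroE by (metis pCons_0_0)
    define R' where "R' p = R p + smult (e / f) ((A ^^ N) p)" for p
    have B: "poly_endo (A ^^ n)" for n
      by (intro poly_endoI; induction n) (simp_all add: lin)
    have BQ: "Q ((A ^^ n) p) = (A ^^ n) (Q p)" for n p
      by (induction n) (simp_all add: QA)
    have R': "poly_endo R'"
      unfolding R'_def
      by (intro poly_endoI) (simp_all add: linear_polyD[OF R] linear_polyD[OF B] smult_add_right
          mult.commute)
    have R'S: "R' p = S p" if degp: "degree p < Suc N" for p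
    proof -
      obtain c r where p: "p = smult c x + r" and r: "r = 0 \<or> degree r < N"
        using graded_split_leading[OF graded_monom, of p N] degp by (auto simp: x_def)
      have "R' x = S x"
        using e f by (simp add: R'_def algebra_simps)
      moreover have "R' r = S r"
        using r RS funpow_lowering(1)[OF assms(1), of r N]
        by (auto simp: R'_def lin linear_polyD[OF R] linear_polyD[OF B])
      ultimately show ?thesis
        by (simp add: p lin linear_polyD[OF R'])
    qed
    show ?case
    proof (intro exI[of _ R'] conjI allI impI)
      fix p
      show "R' (A p) = A (R' p)"
        by (simp add: R'_def lin RA funpow_swap1)
      show "Q (R' p) = R' (Q p)"
        by (simp add: R'_def lin RQ BQ)
    qed (use R' R'S in auto)
  qed
  \<comment> \<open>The approximation has to be exact at both places where \<open>S\<close> is applied: \<open>p\<close> and \<open>Q p\<close>.\<close>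
  from approx[of "Suc (max (degree p) (degree (Q p)))"]
  obtain R where RQ: "\<And>p. Q (R p) = R (Q p)" and "R p = S p" "R (Q p) = S (Q p)"
    by (metis less_Suc_eq_le max.cobounded1 max.cobounded2)
  then show ?thesis
    using RQ[of p] by simp
qed

section \<open>Power series in the W-derivative\<close>

text \<open>The operator \<open>\<Sum>j. c j D ^ j\<close>, where \<open>D\<close> maps \<open>x ^ n / w n\<close> to \<open>x ^ (n - 1) / w (n - 1)\<close> and
  constants to 0.\<close>

definition W_series :: "(nat \<Rightarrow> 'a::field) \<Rightarrow> (nat \<Rightarrow> 'a) \<Rightarrow> 'a poly \<Rightarrow> 'a poly" where
  "W_series w c = (THE S. poly_endo S \<and>
     (\<forall>n. S (normalized_power w n) = (\<Sum>k\<le>n. smult (c (n - k)) (normalized_power w k))))"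

text \<open>The operator adjoint to multiplication by \<open>\<psi>\<close> in the algebra of functionals.\<close>

abbreviation dual_op :: "(nat \<Rightarrow> 'a::field) \<Rightarrow> ('a poly \<Rightarrow> 'a) \<Rightarrow> 'a poly \<Rightarrow> 'a poly" where
  "dual_op w \<psi> \<equiv> W_series w (\<lambda>n. \<psi> (normalized_power w n))"

lemma W_translation_eq_W_series: "W_translation w h = W_series w (\<lambda>n. h ^ n / w n)"
  by (simp add: W_translation_def W_series_def)

context
  fixes w :: "nat \<Rightarrow> 'a::field"
  assumes w0: "w 0 = 1" and w: "\<And>n. w n \<noteq> 0"
begin

lemma graded_normalized_power: "graded (normalized_power w)"
  by (intro graded_normalized graded_monom w)

lemma graded_normalized': "graded p \<Longrightarrow> graded (normalized w p)"
  by (intro graded_normalized w)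

lemma W_series_endo: "poly_endo (W_series w c)"
  and W_series_power:
    "W_series w c (normalized_power w n) = (\<Sum>k\<le>n. smult (c (n - k)) (normalized_power w k))"
proof -
  have "\<exists>!S. poly_endo S \<and>
     (\<forall>n. S (normalized_power w n) = (\<Sum>k\<le>n. smult (c (n - k)) (normalized_power w k)))"
    by (intro ex1_linear_graded graded_normalized_power vector_space_smult)
  from theI'[OF this] show "poly_endo (W_series w c)"
    "W_series w c (normalized_power w n) = (\<Sum>k\<le>n. smult (c (n - k)) (normalized_power w k))"
    by (auto simp: W_series_def)
qed

lemma Q_op_facts:
  assumes "graded p"
  shows "poly_endo (Q_op w p)" "Q_op w p (normalized w p 0) = 0"
    "Q_op w p (normalized w p (Suc n)) = normalized w p n"
  using Q_op_spec[where w = w and p = p, OF assms w0 w] by (auto simp: normalized_def w0)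

lemma lowering_Q_op:
  assumes "graded p"
  shows "lowering (Q_op w p)"
  using graded_normalized'[OF assms] Q_op_facts[OF assms]
  by (intro lowering_on_graded[of "normalized w p"]) auto

text \<open>Both operators commute with \<open>D\<close>, which is \<^term>\<open>Q_op w (monom 1)\<close>, and \<open>D\<close> is lowering.
  This avoids the reindexing of a double sum.\<close>

lemma W_series_commute: "W_series w c (W_series w e p) = W_series w e (W_series w c p)"
proof -
  let ?D = "Q_op w (monom 1)"
  note D = Q_op_facts[OF graded_monom]
  have comm: "W_series w c (?D p) = ?D (W_series w c p)" for c p
  proof -
    have "(\<lambda>p. W_series w c (?D p)) = (\<lambda>p. ?D (W_series w c p))"
    proof (rule linear_eq_on_graded[OF graded_normalized_power vector_space_smult])
      fix n
      show "W_series w c (?D (normalized_power w n)) = ?D (W_series w c (normalized_power w n))"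
      proof (cases n)
        case 0
        then show ?thesis
          by (simp add: W_series_power D(2) linear_polyD[OF D(1)] linear_polyD[OF W_series_endo])
      next
        case (Suc m)
        show ?thesis
          unfolding Suc D(3) W_series_power linear_polyD[OF D(1)]
          by (simp only: sum.atMost_Suc_shift D(2,3)) simp
      qed
    qed (rule linear_compose_endo[OF vector_space_smult]; rule W_series_endo D(1))+
    then show ?thesis by metis
  qed
  show ?thesis
    by (rule commutant_of_lowering_commutes[OF lowering_Q_op[OF graded_monom]])
      (intro W_series_endo comm)+
qed

text \<open>The hypothesis concerns translation by 1 only, so it has the same force over finite and
  infinite fields.  Subtracting the identity removes the constant term of the series and leaves a
  lowering operator, because the next coefficient \<open>1 / w 1\<close> is not 0.\<close>

lemma commutes_with_translation_imp_commutes_with_W_series: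
  assumes Q: "poly_endo Q" and T: "Q \<circ> W_translation w 1 = W_translation w 1 \<circ> Q"
  shows "Q (W_series w c p) = W_series w c (Q p)"
proof -
  let ?e = "\<lambda>n. 1 ^ n / w n"
  let ?A = "\<lambda>p. W_series w ?e p - p"
  note S = linear_polyD[OF W_series_endo]
  have T': "Q (W_series w ?e p) = W_series w ?e (Q p)" for p
    using T by (metis W_translation_eq_W_series comp_apply)
  have A: "poly_endo ?A"
    by (intro poly_endoI) (simp_all add: S smult_diff_right)
  have "lowering ?A"
  proof (rule lowering_on_graded[OF graded_normalized_power A])
    show "?A (normalized_power w 0) = 0"
      by (simp add: W_series_power w0)
    have "?A (normalized_power w (Suc n)) =
        (\<Sum>k\<le>n. smult (?e (Suc n - k)) (normalized_power w k))" for n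
      by (simp add: W_series_power w0)
    then show "graded (\<lambda>n. ?A (normalized_power w (Suc n)))"
      unfolding graded_def
      using graded_sum_leading[OF graded_normalized_power, of "\<lambda>k. ?e (Suc n - k)" n for n] w
      by simp
  qed
  then show ?thesis
    by (rule commutant_of_lowering_commutes)
      (simp_all add: W_series_endo Q S linear_polyD[OF Q] T'[simplified] W_series_commute[of c])
qed

section \<open>The product of functionals\<close>

lemma W_prod_commute: "W_prod w \<phi> \<psi> = W_prod w \<psi> \<phi>"
proof -
  have "(\<Sum>k\<le>n. \<phi> (normalized_power w k) * \<psi> (normalized_power w (n - k))) =
      (\<Sum>k\<le>n. \<psi> (normalized_power w k) * \<phi> (normalized_power w (n - k)))" for n
    by (rule sum.reindex_bij_witness[of _ "\<lambda>k. n - k" "\<lambda>k. n - k"]) auto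
  then show ?thesis
    by (simp add: W_prod_def)
qed

lemma W_prod_eq_dual_op:
  assumes "\<phi> \<in> poly_dual"
  shows "W_prod w \<phi> \<psi> p = \<phi> (dual_op w \<psi> p)"
proof -
  have \<phi>: "Vector_Spaces.linear smult (*) \<phi>"
    using assms by (simp add: poly_dual_def)
  have prod: "Vector_Spaces.linear smult (*) (W_prod w \<phi> \<psi>)"
    "W_prod w \<phi> \<psi> (normalized_power w n) =
       (\<Sum>k\<le>n. \<phi> (normalized_power w k) * \<psi> (normalized_power w (n - k)))" for n
    using W_prod_spec[OF w, where \<phi> = \<phi> and \<psi> = \<psi>] by (simp_all add: poly_dual_def)
  have "W_prod w \<phi> \<psi> = (\<lambda>p. \<phi> (dual_op w \<psi> p))"
  proof (rule linear_eq_on_graded[OF graded_normalized_power vector_space_times prod(1)])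
    show "Vector_Spaces.linear smult (*) (\<lambda>p. \<phi> (dual_op w \<psi> p))"
      by (rule linear_compose_endo[OF vector_space_times \<phi> W_series_endo])
    show "W_prod w \<phi> \<psi> (normalized_power w n) = \<phi> (dual_op w \<psi> (normalized_power w n))" for n
      by (simp add: prod(2) W_series_power linear_polyD[OF \<phi>] mult.commute)
  qed
  then show ?thesis by simp
qed

section \<open>Sheffer sequences\<close>

text \<open>The sequence \<open>d\<close> is graded because it starts with the constant \<open>\<pi> (p 0 / w 0) = 1\<close> and
  \<open>Q\<close>, which commutes with \<open>S\<^sub>\<pi>\<close>, maps \<open>d (n + 1) / w (n + 1)\<close> to \<open>d n / w n\<close> and lowers
  degrees by one.\<close>

lemma W_Sheffer_expansion:
  assumes "W_Sheffer w p"
  obtains d where "graded d"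
    "\<And>\<psi> n. \<psi> \<in> poly_dual \<Longrightarrow> dual_op w \<psi> (normalized w p n) =
       (\<Sum>k\<le>n. smult (\<psi> (normalized w d (n - k))) (normalized w p k))"
proof -
  have p: "graded p"
    using assms by (simp add: W_Sheffer_def)
  let ?P = "normalized w p" and ?Q = "Q_op w p"
  note P = graded_normalized'[OF p] and Q = Q_op_facts[OF p]
  note linQ = linear_polyD[OF Q(1)] and linS = linear_polyD[OF W_series_endo]
  have Qlow: "?Q r = 0 \<longleftrightarrow> degree r = 0" "degree (?Q r) = degree r - 1" for r
    using lowering_Q_op[OF p] by (auto simp: lowering_def)
  have QS: "?Q (W_series w c r) = W_series w c (?Q r)" for c r
    using assms by (intro commutes_with_translation_imp_commutes_with_W_series Q(1))
      (simp add: W_Sheffer_def)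
  obtain \<pi> where \<pi>: "Vector_Spaces.linear smult (*) \<pi>" "\<And>n. \<pi> (?P n) = (if n = 0 then 1 else 0)"
    using ex1_implies_ex[OF ex1_linear_graded[OF P vector_space_times,
        where f = "\<lambda>n. if n = 0 then 1 else 0"]] by auto
  note lin\<pi> = linear_polyD[OF \<pi>(1)]
  obtain a where a: "?P 0 = [:a:]"
    using P by (metis degree_eq_zeroE graded_def)
  define d where "d n = smult (w n) (dual_op w \<pi> (?P n))" for n
  have d: "normalized w d n = dual_op w \<pi> (?P n)" for n
    by (simp add: d_def normalized_def w)
  have "dual_op w \<pi> (?P n) \<noteq> 0 \<and> degree (dual_op w \<pi> (?P n)) = n" for n
  proof (induction n)
    case 0
    have one: "normalized_power w 0 = 1"
      by (simp add: normalized_def w0)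
    have P0: "?P 0 = smult a 1"
      by (simp add: a)
    have "dual_op w \<pi> 1 = smult (\<pi> 1) 1"
      using W_series_power[of "\<lambda>n. \<pi> (normalized_power w n)" 0] by (simp add: one)
    then have "dual_op w \<pi> (?P 0) = smult (a * \<pi> 1) 1"
      unfolding P0 linS by simp
    also have "a * \<pi> 1 = \<pi> (?P 0)"
      unfolding P0 lin\<pi> ..
    finally show ?case by (simp add: \<pi>(2))
  next
    case (Suc n)
    have "?Q (dual_op w \<pi> (?P (Suc n))) = dual_op w \<pi> (?P n)"
      by (simp add: QS Q(3))
    with Suc show ?case
      using Qlow[of "dual_op w \<pi> (?P (Suc n))"] by (auto simp: linQ)
  qed
  then have "graded d"
    by (simp add: graded_def d_def w)
  moreover have "dual_op w \<psi> (?P n) = (\<Sum>k\<le>n. smult (\<psi> (normalized w d (n - k))) (?P k))"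
    if \<psi>: "\<psi> \<in> poly_dual" for \<psi> n
  proof -
    let ?r = "\<lambda>n. dual_op w \<psi> (?P n) - (\<Sum>k\<le>n. smult (\<psi> (normalized w d (n - k))) (?P k))"
    \<comment> \<open>The kernel of \<open>Q\<close> consists of the multiples of \<open>p 0 / w 0\<close>, on which \<open>\<pi>\<close> is injective.\<close>
    have main: "?r n = 0" if "?Q (?r n) = 0" for n
    proof -
      have "degree (?r n) = 0"
        using that Qlow(1) by blast
      then obtain b where "?r n = [:b:]"
        by (metis degree_eq_zeroE)
      moreover have "a \<noteq> 0"
        using P a by (metis graded_def pCons_0_0)
      ultimately have r: "?r n = smult (b / a) (?P 0)"
        by (simp add: a)
      have "\<pi> (dual_op w \<psi> (?P n)) = \<psi> (dual_op w \<pi> (?P n))"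
        using W_prod_eq_dual_op[of \<pi> \<psi>] W_prod_eq_dual_op[OF \<psi>, of \<pi>] \<pi>(1) W_prod_commute[of \<pi> \<psi>]
        by (simp add: poly_dual_def)
      then have "\<pi> (?r n) = 0"
        by (simp add: lin\<pi> \<pi>(2) d if_distrib[of "(*) _"] cong: if_cong)
      then show ?thesis
        unfolding r lin\<pi> \<pi>(2) by simp
    qed
    have "?r n = 0"
    proof (induction n)
      case 0
      show ?case
        by (intro main) (simp add: linQ QS Q(2) linS)
    next
      case (Suc n)
      have "?Q (?r (Suc n)) = ?r n"
        unfolding linQ QS Q(3) sum.atMost_Suc_shift by (simp add: Q)
      then show ?case
        using Suc by (intro main) simp
    qed
    then show ?thesis by simp
  qed
  ultimately show ?thesis
    using that by blast
qed

lemma W_Sheffer_if_expansion: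
  assumes p: "graded p"
    and expansion: "\<And>\<psi> n. \<psi> \<in> poly_dual \<Longrightarrow> dual_op w \<psi> (normalized w p n) =
       (\<Sum>k\<le>n. smult (\<psi> (normalized w d (n - k))) (normalized w p k))"
  shows "W_Sheffer w p"
  unfolding W_Sheffer_def
proof (intro conjI allI p)
  fix h
  let ?P = "normalized w p" and ?Q = "Q_op w p" and ?T = "W_translation w h"
  note Q = Q_op_facts[OF p]
  have ev: "(\<lambda>p. poly p h) \<in> poly_dual"
    unfolding poly_dual_def by (auto intro: linear_polyI vector_space_times)
  \<comment> \<open>The value of \<open>x ^ n / w n\<close> at \<open>h\<close> is the coefficient \<open>h ^ n / w n\<close> of the translation.\<close>
  have T: "?T = dual_op w (\<lambda>p. poly p h)"
    by (simp add: W_translation_eq_W_series normalized_def poly_monom field_simps)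
  have "?Q (?T (?P n)) = ?T (?Q (?P n))" for n
  proof (cases n)
    case 0
    then show ?thesis
      by (simp add: T expansion[OF ev] linear_polyD[OF Q(1)] linear_polyD[OF W_series_endo] Q(2))
  next
    case (Suc m)
    show ?thesis
      unfolding Suc T Q(3) expansion[OF ev] linear_polyD[OF Q(1)]
      by (simp only: sum.atMost_Suc_shift Q(2,3)) simp
  qed
  moreover have "poly_endo ?T"
    by (simp add: W_translation_eq_W_series W_series_endo)
  ultimately have "(\<lambda>r. ?Q (?T r)) = (\<lambda>r. ?T (?Q r))"
    using Q(1) linear_compose_endo[OF vector_space_smult]
    by (intro linear_eq_on_graded[OF graded_normalized'[OF p] vector_space_smult]) simp_all
  then show "?Q \<circ> ?T = ?T \<circ> ?Q"
    by (simp add: comp_def)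
qed

end

lemma coeff_in_poly_dual: "(\<lambda>p. coeff p m) \<in> poly_dual"
  unfolding poly_dual_def by (auto intro: linear_polyI vector_space_times)

theorem theorem3p4:
  fixes w :: "nat \<Rightarrow> 'a::field" and p :: "nat \<Rightarrow> 'a poly"
  assumes "w 0 = 1" and "\<And>n. w n \<noteq> 0" and "graded p"
  shows "W_Sheffer w p \<longleftrightarrow>
    (\<exists>d. graded d \<and>
      (\<forall>n. \<forall>\<phi>\<in>poly_dual. \<forall>\<psi>\<in>poly_dual.
        W_prod w \<phi> \<psi> (normalized w p n) =
          (\<Sum>k\<le>n. \<phi> (normalized w p k) * \<psi> (normalized w d (n - k)))))"
proof
  assume "W_Sheffer w p"
  then obtain d where d: "graded d"
    "\<And>\<psi> n. \<psi> \<in> poly_dual \<Longrightarrow> dual_op w \<psi> (normalized w p n) =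
       (\<Sum>k\<le>n. smult (\<psi> (normalized w d (n - k))) (normalized w p k))"
    using W_Sheffer_expansion[where w = w and p = p, OF assms(1,2)] by blast
  have "W_prod w \<phi> \<psi> (normalized w p n) =
          (\<Sum>k\<le>n. \<phi> (normalized w p k) * \<psi> (normalized w d (n - k)))"
    if \<phi>: "\<phi> \<in> poly_dual" and \<psi>: "\<psi> \<in> poly_dual" for \<phi> \<psi> n
  proof -
    have lin: "Vector_Spaces.linear smult (*) \<phi>"
      using \<phi> by (simp add: poly_dual_def)
    show ?thesis
      by (simp add: W_prod_eq_dual_op[where w = w, OF assms(1,2) \<phi>] d(2)[OF \<psi>] linear_polyD[OF lin] mult.commute)
  qed
  with d(1) show "\<exists>d. graded d \<and>
      (\<forall>n. \<forall>\<phi>\<in>poly_dual. \<forall>\<psi>\<in>poly_dual.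
        W_prod w \<phi> \<psi> (normalized w p n) =
          (\<Sum>k\<le>n. \<phi> (normalized w p k) * \<psi> (normalized w d (n - k))))"
    by blast
next
  assume "\<exists>d. graded d \<and>
      (\<forall>n. \<forall>\<phi>\<in>poly_dual. \<forall>\<psi>\<in>poly_dual.
        W_prod w \<phi> \<psi> (normalized w p n) =
          (\<Sum>k\<le>n. \<phi> (normalized w p k) * \<psi> (normalized w d (n - k))))"
  then obtain d where d: "\<And>n \<phi> \<psi>. \<phi> \<in> poly_dual \<Longrightarrow> \<psi> \<in> poly_dual \<Longrightarrow>
        W_prod w \<phi> \<psi> (normalized w p n) =
          (\<Sum>k\<le>n. \<phi> (normalized w p k) * \<psi> (normalized w d (n - k)))"
    by blast
  show "W_Sheffer w p"
  proof (rule W_Sheffer_if_expansion[where w = w and p = p, OF assms])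
    fix \<psi> :: "'a poly \<Rightarrow> 'a" and n
    assume \<psi>: "\<psi> \<in> poly_dual"
    show "dual_op w \<psi> (normalized w p n) =
       (\<Sum>k\<le>n. smult (\<psi> (normalized w d (n - k))) (normalized w p k))"
    proof (rule poly_eqI)
      fix m
      show "coeff (dual_op w \<psi> (normalized w p n)) m =
        coeff (\<Sum>k\<le>n. smult (\<psi> (normalized w d (n - k))) (normalized w p k)) m"
        using d[OF coeff_in_poly_dual \<psi>, of m n]
        by (simp add: W_prod_eq_dual_op[where w = w, OF assms(1,2) coeff_in_poly_dual] coeff_sum mult.commute)
    qed
  qed
qed

end
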